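(* Let $\mathcal{F}_n=\{E_1|H_1,\ldots,E_n|H_n\}$ be a p-consistent family of conditional events and $E|H$ a conditional event. The following assertions are equivalent: 1. $\mathcal{F}_n$ p-entails $E|H$; 2. the assessment $\mathcal{P}=(1,\ldots,1,z)$ on $\mathcal{F}_n\cup\{E|H\}$, where $P(E_i|H_i)=1$ for $i=1,\ldots,n$ and $P(E|H)=z$, is coherent if and only if $z=1$; 3. the assessment $\mathcal{P}=(1,\ldots,1,0)$ on $\mathcal{F}_n\cup\{E|H\}$, where $P(E_i|H_i)=1$ for $i=1,\ldots,n$ and $P(E|H)=0$, is not coherent; 4. either there exists a nonempty $\mathcal{S}\subseteq\mathcal{F}_n$ such that $\mathcal{C}(\mathcal{S})\subseteq E|H$ (i.e. $\mathcal{C}(\mathcal{S})$ implies $E|H$), or $H\subseteq E$; 5. there exists a nonempty $\mathcal{S}\subseteq\mathcal{F}_n$ such that $\mathcal{C}(\mathcal{S})$ p-entails $E|H$.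
   Context: Events are elements of a Boolean algebra with sure event $\Omega$ and impossible event $\emptyset$; $AB$ is conjunction, $A\vee B$ disjunction, $A^c$ negation, $A\subseteq B$ logical implication; an event is identified with its indicator. A conditional event $E|H$ is given by events $E,H$ with $H\neq\emptyset$; it is true if $EH$ is true, false if $E^cH$ is true, void if $H^c$ is true. $A|H=B|K$ means $AH=BK$ and $H=K$. Coherence. An assessment $(p_1,\ldots,p_n)$ of real numbers, with $p_i=P(E_i|H_i)$, on a finite list of conditional events $E_1|H_1,\ldots,E_n|H_n$ is coherent if for every nonempty $J\subseteq\{1,\ldots,n\}$ and all real numbers $s_j$ ($j\in J$), the random gain $\mathcal{G}=\sum_{j\in J}s_jH_j(E_j-p_j)$, restricted to $\bigvee_{j\in J}H_j$ (i.e. considering its finitely many values on the possible outcomes implying $\bigvee_{j\in J}H_j$), satisfies $\min\mathcal{G}\le 0\le\max\mathcal{G}$. Assessments on $\mathcal{F}_n\cup\{E|H\}$ are understood on the list of $n+1$ conditional events $E_1|H_1,\ldots,E_n|H_n,E|H$, even if $E|H=E_i|H_i$ for some $i$. p-consistency. A family $\{E_i|H_i: i=1,\ldots,n\}$ is p-consistent if for every $(\alpha_1,\ldots,\alpha_n)\in[0,1)^n$ there is a coherent assessment $(p_1,\ldots,p_n)$ on it with $p_i\ge\alpha_i$ for all $i$. p-entailment. A p-consistent family $\{E_i|H_i: i=1,\ldots,n\}$ p-entails $B|A$ if there is a nonempty $J\subseteq\{1,\ldots,n\}$ such that for every $\alpha\in[0,1)$ there exist $\alpha_i\in[0,1)$,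 $i\in J$, such that for all coherent assessments $(z,p_i, i\in J)$ on $\{B|A,\ E_i|H_i,\ i\in J\}$, with $z=P(B|A)$, $p_i=P(E_i|H_i)$: if $p_i\ge\alpha_i$ for every $i\in J$, then $z\ge\alpha$. A single conditional event p-entails $B|A$ if the one-element family consisting of it does. Quasi conjunction. For a nonempty finite family $\mathcal{S}=\{E_1|H_1,\ldots,E_s|H_s\}$, $\mathcal{C}(\mathcal{S})$ is the conditional event $\bigwedge_{i=1}^s(E_iH_i\vee H_i^c)\,\big|\,\bigvee_{i=1}^sH_i$. Inclusion (Goodman–Nguyen). $A|H$ implies $B|K$, written $A|H\subseteq B|K$, if $AH\subseteq BK$ and $B^cK\subseteq A^cH$. *)

theory Defs
  imports Complex_Main
begin

text \<open>
  Events are elements of an arbitrary Boolean algebra, given by the type class.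
  \<open>Cond E H\<close> stands for the conditional event \<open>E|H\<close>. The requirement that \<open>H\<close> is not the
  impossible event is stated separately, as it cannot be met in the one-element algebra.
  Pairs with the same \<open>H\<close> and the same \<open>E \<sqinter> H\<close> represent the same conditional event;
  no notion below distinguishes between them.
\<close>

datatype 'a cond_event = Cond (event: 'a) (hyp: 'a)

definition is_cond_event :: "'a::boolean_algebra cond_event \<Rightarrow> bool" where
  "is_cond_event x \<longleftrightarrow> hyp x \<noteq> bot"

datatype truth = TRUE | FALSE | VOID

fun when_value :: "'a::boolean_algebra cond_event \<Rightarrow> truth \<Rightarrow> 'a" where
  "when_value (Cond E H) TRUE = inf E H"
| "when_value (Cond E H) FALSE = inf (- E) H"
| "when_value (Cond E H) VOID = - H"

text \<open>
  Families of conditional events are indexed, so repetitions are allowed: the family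
  \<open>(c i)\<close> for \<open>i \<in> I\<close> is given by the function \<open>c\<close> and the finite index set \<open>I\<close>.
  The operators \<open>Inf_fin\<close> and \<open>Sup_fin\<close> are only applied to nonempty finite sets.
\<close>

definition disj_hyps :: "('i \<Rightarrow> 'a::boolean_algebra cond_event) \<Rightarrow> 'i set \<Rightarrow> 'a" where
  "disj_hyps c J = \<Squnion>\<^sub>f\<^sub>i\<^sub>n ((\<lambda>j. hyp (c j)) ` J)"

text \<open>
  The possible outcomes are the constituents: the nonzero conjunctions obtained by choosing
  one of the three truth values for each conditional event. A constituent is below each of
  the events that are true on it, which gives the indicators in \<open>gain\<close>.
\<close>

definition constituents :: "('i \<Rightarrow> 'a::boolean_algebra cond_event) \<Rightarrow> 'i set \<Rightarrow> 'a set" where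
  "constituents c J =
     {x. x \<noteq> bot \<and> (\<exists>t. x = \<Sqinter>\<^sub>f\<^sub>i\<^sub>n ((\<lambda>j. when_value (c j) (t j)) ` J))}"

definition gain ::
  "('i \<Rightarrow> 'a::boolean_algebra cond_event) \<Rightarrow> ('i \<Rightarrow> real) \<Rightarrow> 'i set \<Rightarrow> ('i \<Rightarrow> real) \<Rightarrow> 'a \<Rightarrow> real" where
  "gain c p J s x =
     (\<Sum>j\<in>J. s j * of_bool (x \<le> hyp (c j)) * (of_bool (x \<le> event (c j)) - p j))"

definition gain_values ::
  "('i \<Rightarrow> 'a::boolean_algebra cond_event) \<Rightarrow> ('i \<Rightarrow> real) \<Rightarrow> 'i set \<Rightarrow> ('i \<Rightarrow> real) \<Rightarrow> real set" where
  "gain_values c p J s = gain c p J s ` {x \<in> constituents c J. x \<le> disj_hyps c J}"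

definition coherent ::
  "'i set \<Rightarrow> ('i \<Rightarrow> 'a::boolean_algebra cond_event) \<Rightarrow> ('i \<Rightarrow> real) \<Rightarrow> bool" where
  "coherent I c p \<longleftrightarrow>
     (\<forall>J. J \<subseteq> I \<and> J \<noteq> {} \<longrightarrow>
       (\<forall>s. Min (gain_values c p J s) \<le> 0 \<and> 0 \<le> Max (gain_values c p J s)))"

text \<open>
  Coherence of the assessment \<open>p\<close> on the family indexed by \<open>I\<close> together with \<open>z\<close> on one more
  conditional event \<open>x\<close>, which gets the fresh index \<open>None\<close> even if it occurs in the family.
\<close>

definition coherent_with ::
  "'i set \<Rightarrow> ('i \<Rightarrow> 'a::boolean_algebra cond_event) \<Rightarrow> ('i \<Rightarrow> real) \<Rightarrow> 'a cond_event \<Rightarrow> real \<Rightarrow> bool" where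
  "coherent_with I c p x z \<longleftrightarrow>
     coherent (insert None (Some ` I)) (case_option x c) (case_option z p)"

definition p_consistent :: "'i set \<Rightarrow> ('i \<Rightarrow> 'a::boolean_algebra cond_event) \<Rightarrow> bool" where
  "p_consistent I c \<longleftrightarrow>
     (\<forall>\<alpha> :: 'i \<Rightarrow> real. (\<forall>i\<in>I. \<alpha> i \<in> {0..<1}) \<longrightarrow>
       (\<exists>p. coherent I c p \<and> (\<forall>i\<in>I. p i \<ge> \<alpha> i)))"

text \<open>
  Entailment is only defined for p-consistent families, so p-consistency is part of the predicate.
\<close>

definition p_entails ::
  "'i set \<Rightarrow> ('i \<Rightarrow> 'a::boolean_algebra cond_event) \<Rightarrow> 'a cond_event \<Rightarrow> bool" where
  "p_entails I c x \<longleftrightarrow> p_consistent I c \<and>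
     (\<exists>J. J \<subseteq> I \<and> J \<noteq> {} \<and>
       (\<forall>\<alpha>::real. \<alpha> \<in> {0..<1} \<longrightarrow>
         (\<exists>\<beta> :: 'i \<Rightarrow> real. (\<forall>i\<in>J. \<beta> i \<in> {0..<1}) \<and>
           (\<forall>z p. coherent_with J c p x z \<and> (\<forall>i\<in>J. p i \<ge> \<beta> i) \<longrightarrow> z \<ge> \<alpha>))))"

definition p_entails_single ::
  "'a::boolean_algebra cond_event \<Rightarrow> 'a cond_event \<Rightarrow> bool" where
  "p_entails_single y x \<longleftrightarrow> p_entails {()} (\<lambda>_. y) x"

definition quasi_conj ::
  "('i \<Rightarrow> 'a::boolean_algebra cond_event) \<Rightarrow> 'i set \<Rightarrow> 'a cond_event" where
  "quasi_conj c S =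
     Cond (\<Sqinter>\<^sub>f\<^sub>i\<^sub>n ((\<lambda>i. sup (inf (event (c i)) (hyp (c i))) (- hyp (c i))) ` S))
          (disj_hyps c S)"

definition gn_implies ::
  "'a::boolean_algebra cond_event \<Rightarrow> 'a cond_event \<Rightarrow> bool" where
  "gn_implies x y \<longleftrightarrow>
     inf (event x) (hyp x) \<le> inf (event y) (hyp y) \<and>
     inf (- event y) (hyp y) \<le> inf (- event x) (hyp x)"

end

theory Submission
  imports Defs
begin

text \<open>
  A set of conditional events is tolerated if some possible case makes one of them true and none
  of them false. This purely logical notion carries the whole proof, in two steps.

  First, tolerance decides coherence of the all-ones assessment: it is coherent iff every nonempty
  subset is tolerated (\<open>coherent_one_iff\<close>). If \<open>J\<close> is tolerated, the gain vanishes in the tolerating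
  case. If \<open>J\<close> is not tolerated, every case in which one of its hypotheses holds falsifies some member,
  so betting a unit on each member of \<open>J\<close> yields at most \<open>(\<Sum>j\<in>J. 1 - p j) - 1\<close>; coherence then gives the
  bound \<open>1 \<le> (\<Sum>j\<in>J. 1 - p j)\<close> (\<open>uncertainty_bound\<close>). The bound is quantitative, so the same
  argument covers assessments close to one: p-consistency means that all nonempty subsets are
  tolerated (\<open>p_consistent_iff\<close>).

  Second, price \<open>z\<close> on \<open>E|H\<close> amounts to price \<open>1 - z\<close> on the negation \<open>E\<^sup>c|H\<close>. Hence
  \<open>(1,\<dots>,1,0)\<close> is incoherent iff, for some subfamily \<open>S\<close>, the set made of \<open>S\<close> and \<open>E\<^sup>c|H\<close> is not
  tolerated. The bound above, applied to this set, reads \<open>z \<ge> 1 - (\<Sum>i\<in>S. 1 - p i)\<close>, which is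
  p-entailment; conversely, p-entailment forces \<open>z = 1\<close> when all the premises have probability one.
  That \<open>z = 1\<close> is then coherent follows because a p-consistent family cannot reject both \<open>E|H\<close> and
  its negation (\<open>tolerated_insert_negated\<close>).
  Spelled out in the Boolean algebra, the failure of tolerance says for nonempty \<open>S\<close> that the quasi
  conjunction of \<open>S\<close> implies \<open>E|H\<close> (\<open>gn_implies_quasi_conj_iff\<close>), and for empty \<open>S\<close> that
  \<open>H \<subseteq> E\<close>. Applying this result to the one-element family consisting of a quasi conjunction
  gives the assertion on single premises.
\<close>

section \<open>Constituents\<close>

lemma le_compl_le_imp_bot:
  fixes x a :: "'a::boolean_algebra"
  assumes "x \<le> a" "x \<le> - a"
  shows "x = bot"
proof -
  have "x \<le> inf a (- a)" using assms by (rule inf_greatest)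
  then show ?thesis by (simp add: bot_unique)
qed

lemma when_value_le_cases:
  assumes "x \<le> when_value c t"
  shows "(x \<le> hyp c \<and> x \<le> event c) \<or> (x \<le> hyp c \<and> x \<le> - event c) \<or> x \<le> - hyp c"
  using assms by (cases c; cases t) auto

lemma constituent_nonbot: "x \<in> constituents c J \<Longrightarrow> x \<noteq> bot"
  by (simp add: constituents_def)

lemma constituent_cases:
  assumes "x \<in> constituents c J" "finite J" "j \<in> J"
  shows "(x \<le> hyp (c j) \<and> x \<le> event (c j)) \<or> (x \<le> hyp (c j) \<and> x \<le> - event (c j)) \<or> x \<le> - hyp (c j)"
proof -
  obtain t where x: "x = \<Sqinter>\<^sub>f\<^sub>i\<^sub>n ((\<lambda>j. when_value (c j) (t j)) ` J)"
    using assms(1) by (auto simp: constituents_def)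
  have "x \<le> when_value (c j) (t j)"
    unfolding x using assms by (intro Inf_fin.coboundedI) auto
  then show ?thesis by (rule when_value_le_cases)
qed

lemma constituent_not_le_compl:
  assumes "x \<in> constituents c J" "x \<le> a"
  shows "\<not> x \<le> - a"
  using assms le_compl_le_imp_bot constituent_nonbot by blast

text \<open>A choice of truth values is a function on the whole index type, which may be infinite; but a
  constituent is the meet of a subset of the finitely many events that fix one truth value.\<close>

lemma finite_constituents:
  assumes "finite J"
  shows "finite (constituents c J)"
proof -
  define V where "V = (\<Union>j\<in>J. when_value (c j) ` {TRUE, FALSE, VOID})"
  have "constituents c J \<subseteq> Inf_fin ` Pow V"
  proof
    fix x assume "x \<in> constituents c J"
    then obtain t where x: "x = \<Sqinter>\<^sub>f\<^sub>i\<^sub>n ((\<lambda>j. when_value (c j) (t j)) ` J)"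
      by (auto simp: constituents_def)
    have "t j \<in> {TRUE, FALSE, VOID}" for j by (cases "t j") auto
    then have "(\<lambda>j. when_value (c j) (t j)) ` J \<subseteq> V"
      unfolding V_def by blast
    then show "x \<in> Inf_fin ` Pow V" unfolding x by blast
  qed
  moreover have "finite V" unfolding V_def using assms by simp
  ultimately show ?thesis by (meson finite_Pow_iff finite_imageI finite_subset)
qed

text \<open>The three truth values of one conditional event partition the sure event, so some choice of a
  truth value meets any given nonzero event; doing this for one index after the other reaches a
  whole constituent.\<close>

lemma when_value_meets:
  fixes y :: "'a::boolean_algebra"
  assumes "y \<noteq> bot"
  shows "\<exists>t. inf y (when_value c t) \<noteq> bot"
proof (rule ccontr)
  assume "\<not> ?thesis"
  then have *: "inf y (when_value c t) = bot" for t by blast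
  obtain E H where c: "c = Cond E H" by (cases c)
  have "inf (inf y H) E = bot" "inf (inf y H) (- E) = bot" "inf y (- H) = bot"
    using *[of TRUE] *[of FALSE] *[of VOID] by (simp_all add: c ac_simps)
  then have "inf y H \<le> - E" "inf y H \<le> E" "y \<le> H"
    by (simp_all add: inf_shunt)
  then have "y = bot" using le_compl_le_imp_bot by (metis inf.absorb1)
  then show False using assms by simp
qed

lemma constituent_meets:
  fixes y :: "'a::boolean_algebra"
  assumes "finite J" "J \<noteq> {}" "y \<noteq> bot"
  obtains x where "x \<in> constituents c J" "inf x y \<noteq> bot"
proof -
  have "\<exists>t. inf y (\<Sqinter>\<^sub>f\<^sub>i\<^sub>n ((\<lambda>j. when_value (c j) (t j)) ` J)) \<noteq> bot"
    using assms
  proof (induction J arbitrary: y rule: finite_ne_induct)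
    case (singleton j)
    then obtain t where "inf y (when_value (c j) t) \<noteq> bot" using when_value_meets by blast
    then show ?case by (intro exI[of _ "\<lambda>_. t"]) simp
  next
    case (insert j J)
    then obtain u where "inf y (when_value (c j) u) \<noteq> bot" using when_value_meets by blast
    then obtain t where
      t: "inf (inf y (when_value (c j) u)) (\<Sqinter>\<^sub>f\<^sub>i\<^sub>n ((\<lambda>j. when_value (c j) (t j)) ` J)) \<noteq> bot"
      using insert.IH by blast
    have "(\<lambda>i. when_value (c i) ((t(j := u)) i)) ` J = (\<lambda>i. when_value (c i) (t i)) ` J"
      using insert.hyps by (intro image_cong) auto
    then show ?case using t insert.hyps
      by (intro exI[of _ "t(j := u)"]) (simp add: inf_assoc del: fun_upd_apply, simp)
  qed
  then obtain t where t: "inf y (\<Sqinter>\<^sub>f\<^sub>i\<^sub>n ((\<lambda>j. when_value (c j) (t j)) ` J)) \<noteq> bot" by blast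
  then have "\<Sqinter>\<^sub>f\<^sub>i\<^sub>n ((\<lambda>j. when_value (c j) (t j)) ` J) \<in> constituents c J"
    by (auto simp: constituents_def)
  with t that show ?thesis by (metis inf_commute)
qed

lemma hyp_le_disj_hyps: "finite J \<Longrightarrow> j \<in> J \<Longrightarrow> hyp (c j) \<le> disj_hyps c J"
  unfolding disj_hyps_def by (intro Sup_fin.coboundedI) auto

lemma disj_hyps_le_iff:
  "finite J \<Longrightarrow> J \<noteq> {} \<Longrightarrow> disj_hyps c J \<le> a \<longleftrightarrow> (\<forall>j\<in>J. hyp (c j) \<le> a)"
  unfolding disj_hyps_def by (simp add: Sup_fin.bounded_iff)

lemma constituent_le_hyp:
  assumes "x \<in> constituents c J" "x \<le> disj_hyps c J" "finite J" "J \<noteq> {}"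
  shows "\<exists>j\<in>J. x \<le> hyp (c j)"
proof (rule ccontr)
  assume "\<not> ?thesis"
  then have "x \<le> - hyp (c j)" if "j \<in> J" for j
    using constituent_cases[OF assms(1,3) that] that by blast
  then have "disj_hyps c J \<le> - x"
    using assms(3,4) by (simp add: disj_hyps_le_iff compl_le_swap1)
  then show False
    using assms(1,2) constituent_nonbot le_compl_le_imp_bot order_trans by blast
qed

section \<open>Coherence\<close>

text \<open>Some hypothesis in \<open>J\<close> is possible, so the set of gain values is nonempty and its maximum is
  attained. The lower half of coherence is this statement for the opposite stakes.\<close>

lemma coherent_gain_nonneg:
  assumes "coherent I c p" "J \<subseteq> I" "finite J" "J \<noteq> {}" "\<forall>j\<in>J. is_cond_event (c j)"
  obtains x where "x \<in> constituents c J" "x \<le> disj_hyps c J" "gain c p J s x \<ge> 0"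
proof -
  define X where "X = {x \<in> constituents c J. x \<le> disj_hyps c J}"
  have "finite X" using finite_constituents[OF assms(3), of c] by (simp add: X_def)
  obtain j where j: "j \<in> J" using assms(4) by blast
  then have "hyp (c j) \<noteq> bot" using assms(5) by (simp add: is_cond_event_def)
  then obtain x where x: "x \<in> constituents c J" "inf x (hyp (c j)) \<noteq> bot"
    using constituent_meets assms(3,4) by blast
  then have "\<not> x \<le> - hyp (c j)" by (metis inf_shunt)
  then have "x \<le> disj_hyps c J"
    using constituent_cases[OF x(1) assms(3) j] hyp_le_disj_hyps[OF assms(3) j, of c]
    by (meson order_trans)
  then have "X \<noteq> {}" using x by (auto simp: X_def)
  have "0 \<le> Max (gain c p J s ` X)"
    using assms by (simp add: coherent_def gain_values_def X_def)
  moreover have "Max (gain c p J s ` X) \<in> gain c p J s ` X"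
    using \<open>finite X\<close> \<open>X \<noteq> {}\<close> by (intro Max_in) auto
  ultimately show ?thesis using that by (auto simp: X_def)
qed

lemma coherent_subset: "coherent I c p \<Longrightarrow> J \<subseteq> I \<Longrightarrow> coherent J c p"
  unfolding coherent_def by blast

lemma coherent_le_1:
  assumes "coherent I c p" "i \<in> I" "is_cond_event (c i)"
  shows "p i \<le> 1"
proof -
  obtain x where x: "x \<in> constituents c {i}" "x \<le> disj_hyps c {i}" "gain c p {i} (\<lambda>_. 1) x \<ge> 0"
    using coherent_gain_nonneg[of I c p "{i}"] assms by auto
  then have "x \<le> hyp (c i)" by (simp add: disj_hyps_def)
  with x(3) show ?thesis by (auto simp: gain_def of_bool_def split: if_splits)
qed

definition negated :: "'a::boolean_algebra cond_event \<Rightarrow> 'a cond_event" where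
  "negated x = Cond (- event x) (hyp x)"

lemma negated_simps [simp]:
  "event (negated x) = - event x" "hyp (negated x) = hyp x" "negated (negated x) = x"
  "is_cond_event (negated x) \<longleftrightarrow> is_cond_event x"
  by (simp_all add: negated_def is_cond_event_def)

text \<open>Negating a conditional event permutes its truth values, so the constituents stay the same.\<close>

fun opposite :: "truth \<Rightarrow> truth" where
  "opposite TRUE = FALSE" | "opposite FALSE = TRUE" | "opposite VOID = VOID"

lemma when_value_negated: "when_value (negated x) t = when_value x (opposite t)"
  by (cases x; cases t) (simp_all add: negated_def)

lemma constituents_negated_subset:
  "constituents (\<lambda>i. if i \<in> N then negated (c i) else c i) J \<subseteq> constituents c J"
proof
  fix x assume "x \<in> constituents (\<lambda>i. if i \<in> N then negated (c i) else c i) J"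
  then obtain t where "x \<noteq> bot"
    and x: "x = \<Sqinter>\<^sub>f\<^sub>i\<^sub>n ((\<lambda>j. when_value (if j \<in> N then negated (c j) else c j) (t j)) ` J)"
    by (auto simp: constituents_def)
  have "when_value (if j \<in> N then negated (c j) else c j) (t j)
      = when_value (c j) (if j \<in> N then opposite (t j) else t j)" for j
    by (simp add: when_value_negated)
  then show "x \<in> constituents c J"
    using x \<open>x \<noteq> bot\<close> unfolding constituents_def
    by (intro CollectI conjI exI[of _ "\<lambda>j. if j \<in> N then opposite (t j) else t j"]) auto
qed

lemma constituents_negated:
  "constituents (\<lambda>i. if i \<in> N then negated (c i) else c i) J = constituents c J"
proof (rule antisym[OF constituents_negated_subset])
  let ?c = "\<lambda>i. if i \<in> N then negated (c i) else c i"
  have "(\<lambda>i. if i \<in> N then negated (?c i) else ?c i) = c" by auto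
  then show "constituents c J \<subseteq> constituents ?c J"
    using constituents_negated_subset[of N ?c J] by simp
qed

text \<open>Betting on \<open>E|H\<close> at price \<open>p\<close> is betting against its negation at price \<open>1 - p\<close>, so only the
  signs of the stakes change.\<close>

lemma coherent_negated:
  assumes "coherent I c p" "finite I"
  shows "coherent I (\<lambda>i. if i \<in> N then negated (c i) else c i) (\<lambda>i. if i \<in> N then 1 - p i else p i)"
    (is "coherent I ?c ?p")
  unfolding coherent_def
proof (intro allI impI)
  fix J and s :: "'a \<Rightarrow> real" assume J: "J \<subseteq> I \<and> J \<noteq> {}"
  let ?s = "\<lambda>i. if i \<in> N then - s i else s i"
  have fin: "finite J" using J assms(2) finite_subset by blast
  have disj: "disj_hyps ?c J = disj_hyps c J"
    unfolding disj_hyps_def by (intro arg_cong[where f = Sup_fin] image_cong) auto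
  have gain: "gain ?c ?p J s x = gain c p J ?s x" if x: "x \<in> constituents c J" for x
    unfolding gain_def
  proof (rule sum.cong[OF refl])
    fix j assume "j \<in> J"
    from constituent_cases[OF x fin this]
    show "s j * of_bool (x \<le> hyp (?c j)) * (of_bool (x \<le> event (?c j)) - ?p j)
        = ?s j * of_bool (x \<le> hyp (c j)) * (of_bool (x \<le> event (c j)) - p j)"
      using constituent_not_le_compl[OF x, of "event (c j)"]
        constituent_not_le_compl[OF x, of "hyp (c j)"]
      by (auto simp: algebra_simps)
  qed
  have "gain_values ?c ?p J s = gain_values c p J ?s"
    unfolding gain_values_def constituents_negated disj by (intro image_cong) (auto simp: gain)
  then show "Min (gain_values ?c ?p J s) \<le> 0 \<and> 0 \<le> Max (gain_values ?c ?p J s)"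
    using assms(1) J unfolding coherent_def by simp
qed

lemma coherent_with_negated_imp:
  assumes "coherent_with I c p x z" "finite I"
  shows "coherent_with I c p (negated x) (1 - z)"
proof -
  have "(\<lambda>i. if i \<in> {None} then negated (case_option x c i) else case_option x c i)
        = case_option (negated x) c"
    by (auto simp: fun_eq_iff split: option.split)
  moreover have "(\<lambda>i. if i \<in> {None} then 1 - case_option z p i else case_option z p i)
        = case_option (1 - z) p"
    by (auto simp: fun_eq_iff split: option.split)
  ultimately show ?thesis
    using coherent_negated[of "insert None (Some ` I)" "case_option x c" "case_option z p" "{None}"] assms
    by (simp add: coherent_with_def)
qed

lemma coherent_with_negated:
  "finite I \<Longrightarrow> coherent_with I c p (negated x) (1 - z) \<longleftrightarrow> coherent_with I c p x z"
  using coherent_with_negated_imp[of I c p x z] coherent_with_negated_imp[of I c p "negated x" "1 - z"]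
  by auto

section \<open>Tolerance\<close>

text \<open>The notion is Adams' tolerance: not falsifying \<open>E|H\<close> in the case \<open>y\<close> means \<open>y \<sqinter> H \<le> E\<close>. The
  witness is any nonzero event, which avoids the meets and joins over \<open>J\<close> and lets
  indices be added or removed freely.\<close>

definition tolerated :: "('i \<Rightarrow> 'a::boolean_algebra cond_event) \<Rightarrow> 'i set \<Rightarrow> bool" where
  "tolerated c J \<longleftrightarrow>
     (\<exists>y. y \<noteq> bot \<and> (\<exists>j\<in>J. y \<le> hyp (c j)) \<and> (\<forall>i\<in>J. inf y (hyp (c i)) \<le> event (c i)))"

text \<open>A constituent meeting the case \<open>y\<close> that witnesses tolerance inherits the truth values forced on
  \<open>y\<close>, since it already decides every member of \<open>J\<close>.\<close>

lemma tolerated_constituent: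
  assumes "finite J" "J \<noteq> {}" "tolerated c J"
  obtains x where "x \<in> constituents c J" "x \<le> disj_hyps c J"
    "\<forall>i\<in>J. x \<le> hyp (c i) \<longrightarrow> x \<le> event (c i)"
proof -
  obtain y j where y: "y \<noteq> bot" "j \<in> J" "y \<le> hyp (c j)" "\<forall>i\<in>J. inf y (hyp (c i)) \<le> event (c i)"
    using assms(3) by (auto simp: tolerated_def)
  obtain x where x: "x \<in> constituents c J" "inf x y \<noteq> bot"
    using constituent_meets assms(1,2) y(1) by blast
  have compatible: "\<not> x \<le> - a" if "y \<le> a" for a
  proof
    assume "x \<le> - a"
    then have "inf x y \<le> inf (- a) a" using that by (rule inf_mono)
    then show False using x(2) by (simp add: bot_unique)
  qed
  have "x \<le> hyp (c j)"
    using constituent_cases[OF x(1) assms(1) y(2)] compatible[OF y(3)] by blast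
  then have "x \<le> disj_hyps c J"
    using hyp_le_disj_hyps[OF assms(1) y(2)] order_trans by blast
  moreover have "x \<le> event (c i)" if i: "i \<in> J" "x \<le> hyp (c i)" for i
  proof (rule ccontr)
    assume "\<not> ?thesis"
    then have *: "x \<le> - event (c i)"
      using constituent_cases[OF x(1) assms(1) i(1)] constituent_not_le_compl[OF x(1) i(2)] by blast
    have "inf x y \<le> inf y (hyp (c i))" using i(2) by (meson inf_le1 inf_le2 le_inf_iff order_trans)
    also have "\<dots> \<le> event (c i)" using y(4) i(1) by blast
    finally have "inf x y \<le> event (c i)" .
    moreover have "inf x y \<le> - event (c i)" using * by (rule le_infI1)
    ultimately show False using x(2) le_compl_le_imp_bot by blast
  qed
  ultimately show ?thesis using that x(1) by blast
qed

text \<open>Bet one unit on every member of \<open>J\<close>. A term of the gain never exceeds \<open>1 - p j\<close>, and on a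
  constituent that falsifies the \<open>k\<close>-th event its term is \<open>- p k\<close>, which is smaller by one. Without
  tolerance every relevant constituent falsifies some member, yet coherence demands a
  nonnegative gain on one of them.\<close>

lemma uncertainty_bound:
  assumes coh: "coherent I c p" and J: "J \<subseteq> I" "finite J" "J \<noteq> {}" "\<forall>j\<in>J. is_cond_event (c j)"
    and nt: "\<not> tolerated c J"
  shows "1 \<le> (\<Sum>j\<in>J. 1 - p j)"
proof -
  obtain x where x: "x \<in> constituents c J" "x \<le> disj_hyps c J" "gain c p J (\<lambda>_. 1) x \<ge> 0"
    using coherent_gain_nonneg[OF coh J] .
  have "\<exists>k\<in>J. \<not> inf x (hyp (c k)) \<le> event (c k)"
    using nt constituent_le_hyp[OF x(1,2) J(2,3)] constituent_nonbot[OF x(1)]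
    unfolding tolerated_def by blast
  then obtain k where k: "k \<in> J" "\<not> inf x (hyp (c k)) \<le> event (c k)" by blast
  then have "\<not> x \<le> event (c k)" by (meson le_infI1)
  moreover have "\<not> x \<le> - hyp (c k)" using k(2) by (metis inf_shunt bot_least)
  ultimately have *: "x \<le> hyp (c k)" "\<not> x \<le> event (c k)"
    using constituent_cases[OF x(1) J(2) k(1)] by blast+
  have "gain c p J (\<lambda>_. 1) x \<le> (\<Sum>j\<in>J. 1 - p j - of_bool (j = k))"
    unfolding gain_def
  proof (rule sum_mono)
    fix j assume "j \<in> J"
    then have "p j \<le> 1" using coherent_le_1[OF coh] J by blast
    then show "1 * of_bool (x \<le> hyp (c j)) * (of_bool (x \<le> event (c j)) - p j)
        \<le> 1 - p j - of_bool (j = k)"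
      using * by (auto simp: of_bool_def)
  qed
  also have "\<dots> = (\<Sum>j\<in>J. 1 - p j) - 1"
    using J(2) k(1) by (simp only: sum_subtractf[of "\<lambda>j. 1 - p j"]) (simp add: of_bool_def)
  finally show ?thesis using x(3) by simp
qed

lemma coherent_one_iff:
  assumes "finite I" "\<forall>i\<in>I. is_cond_event (c i)"
  shows "coherent I c (\<lambda>_. 1) \<longleftrightarrow> (\<forall>J. J \<subseteq> I \<and> J \<noteq> {} \<longrightarrow> tolerated c J)"
proof (intro iffI allI impI)
  fix J assume coh: "coherent I c (\<lambda>_. 1)" and J: "J \<subseteq> I \<and> J \<noteq> {}"
  have "finite J" using J assms(1) finite_subset by blast
  moreover have "\<forall>j\<in>J. is_cond_event (c j)" using J assms(2) by blast
  ultimately show "tolerated c J"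
    using uncertainty_bound[OF coh, of J] J by auto
next
  assume tol: "\<forall>J. J \<subseteq> I \<and> J \<noteq> {} \<longrightarrow> tolerated c J"
  show "coherent I c (\<lambda>_. 1)"
    unfolding coherent_def
  proof (intro allI impI)
    fix J and s :: "'a \<Rightarrow> real" assume J: "J \<subseteq> I \<and> J \<noteq> {}"
    have fin: "finite J" using J assms(1) finite_subset by blast
    obtain x where x: "x \<in> constituents c J" "x \<le> disj_hyps c J"
      "\<forall>i\<in>J. x \<le> hyp (c i) \<longrightarrow> x \<le> event (c i)"
      using tolerated_constituent[OF fin] J tol by blast
    have "gain c (\<lambda>_. 1) J s x = 0"
      unfolding gain_def using x(3) by (intro sum.neutral) auto
    then have "0 \<in> gain_values c (\<lambda>_. 1) J s"
      unfolding gain_values_def using x(1,2) by (intro image_eqI[of _ _ x]) auto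
    moreover have "finite (gain_values c (\<lambda>_. 1) J s)"
      unfolding gain_values_def using finite_constituents[OF fin, of c] by simp
    ultimately show "Min (gain_values c (\<lambda>_. 1) J s) \<le> 0 \<and> 0 \<le> Max (gain_values c (\<lambda>_. 1) J s)"
      by auto
  qed
qed

text \<open>Prices of at least \<open>1 - 1 / (card J + 1)\<close> already violate \<open>uncertainty_bound\<close> on a set \<open>J\<close> that is not
  tolerated; if there is no such set, all prices can be one.\<close>

lemma p_consistent_iff:
  assumes "finite I" "\<forall>i\<in>I. is_cond_event (c i)"
  shows "p_consistent I c \<longleftrightarrow> (\<forall>J. J \<subseteq> I \<and> J \<noteq> {} \<longrightarrow> tolerated c J)"
proof
  assume "\<forall>J. J \<subseteq> I \<and> J \<noteq> {} \<longrightarrow> tolerated c J"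
  then have "coherent I c (\<lambda>_. 1)" using coherent_one_iff[OF assms] by blast
  then show "p_consistent I c"
    unfolding p_consistent_def by (intro allI impI exI[of _ "\<lambda>_. 1"]) auto
next
  assume pc: "p_consistent I c"
  show "\<forall>J. J \<subseteq> I \<and> J \<noteq> {} \<longrightarrow> tolerated c J"
  proof (intro allI impI, rule ccontr)
    fix J assume J: "J \<subseteq> I \<and> J \<noteq> {}" and nt: "\<not> tolerated c J"
    have fin: "finite J" using J assms(1) finite_subset by blast
    define e :: real where "e = 1 / (real (card J) + 1)"
    have "1 - e \<in> {0..<1}" by (auto simp: e_def)
    then obtain p where p: "coherent I c p" "\<forall>i\<in>I. p i \<ge> 1 - e"
      using pc unfolding p_consistent_def by (elim allE[of _ "\<lambda>_. 1 - e"]) auto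
    have "1 \<le> (\<Sum>j\<in>J. 1 - p j)"
      using uncertainty_bound[OF p(1) _ fin _ _ nt] J assms(2) by blast
    also have "\<dots> \<le> of_nat (card J) * e"
      using p(2) J by (intro sum_bounded_above) fastforce
    also have "\<dots> < 1" by (simp add: e_def)
    finally show False by simp
  qed
qed

section \<open>Entailment\<close>

lemma tolerated_insert:
  "tolerated (case_option x c) (insert None (Some ` S)) \<longleftrightarrow>
     (\<exists>y. y \<noteq> bot \<and> (y \<le> hyp x \<or> (\<exists>j\<in>S. y \<le> hyp (c j))) \<and>
          inf y (hyp x) \<le> event x \<and> (\<forall>i\<in>S. inf y (hyp (c i)) \<le> event (c i)))"
  unfolding tolerated_def by auto

lemma tolerated_Some: "tolerated (case_option x c) (Some ` S) \<longleftrightarrow> tolerated c S"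
  unfolding tolerated_def by auto

text \<open>Sets that leave out the additional event are tolerated by p-consistency, so only those containing
  it matter.\<close>

lemma coherent_with_one_iff:
  assumes "finite I" "\<forall>i\<in>I. is_cond_event (c i)" "p_consistent I c" "is_cond_event x"
  shows "coherent_with I c (\<lambda>_. 1) x 1 \<longleftrightarrow>
    (\<forall>S\<subseteq>I. tolerated (case_option x c) (insert None (Some ` S)))"
    (is "?L \<longleftrightarrow> ?R")
proof -
  have one: "case_option 1 (\<lambda>_. 1) = (\<lambda>_. 1::real)"
    by (auto simp: fun_eq_iff split: option.split)
  have "?L \<longleftrightarrow> (\<forall>J. J \<subseteq> insert None (Some ` I) \<and> J \<noteq> {} \<longrightarrow> tolerated (case_option x c) J)"
    unfolding coherent_with_def one using assms by (intro coherent_one_iff) auto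
  also have "\<dots> \<longleftrightarrow> ?R"
  proof (intro iffI allI impI)
    fix J assume R: ?R and J: "J \<subseteq> insert None (Some ` I) \<and> J \<noteq> {}"
    have "J - {None} \<subseteq> Some ` I" using J by blast
    then obtain S where S: "S \<subseteq> I" "J - {None} = Some ` S" by (meson subset_imageE)
    show "tolerated (case_option x c) J"
    proof (cases "None \<in> J")
      case True
      then have "J = insert None (Some ` S)" using S by blast
      then show ?thesis using R S by blast
    next
      case False
      then have *: "J = Some ` S" using S by blast
      then have "S \<noteq> {}" using J by blast
      then have "tolerated c S" using p_consistent_iff[OF assms(1,2), THEN iffD1, OF assms(3)] S(1) by blast
      then show ?thesis by (simp add: * tolerated_Some)
    qed
  next
    fix S assume "\<forall>J. J \<subseteq> insert None (Some ` I) \<and> J \<noteq> {} \<longrightarrow> tolerated (case_option x c) J"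
      and "S \<subseteq> I"
    then show "tolerated (case_option x c) (insert None (Some ` S))"
      by (metis image_mono insert_mono insert_not_empty)
  qed
  finally show ?thesis .
qed

lemma coherent_with_zero_iff:
  assumes "finite I" "\<forall>i\<in>I. is_cond_event (c i)" "p_consistent I c" "is_cond_event x"
  shows "coherent_with I c (\<lambda>_. 1) x 0 \<longleftrightarrow>
    (\<forall>S\<subseteq>I. tolerated (case_option (negated x) c) (insert None (Some ` S)))"
  using coherent_with_one_iff[of I c "negated x"] coherent_with_negated[of I c "\<lambda>_. 1" x 0] assms
  by simp

lemma coherent_with_subset:
  "coherent_with I c p x z \<Longrightarrow> J \<subseteq> I \<Longrightarrow> coherent_with J c p x z"
  unfolding coherent_with_def by (erule coherent_subset) blast

lemma coherent_with_le_1: "coherent_with I c p x z \<Longrightarrow> is_cond_event x \<Longrightarrow> z \<le> 1"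
  unfolding coherent_with_def by (drule coherent_le_1[of _ _ _ None]) auto

text \<open>Probability one meets every lower bound on the premises.\<close>

lemma p_entails_coherent_one:
  assumes "p_entails I c x" "coherent_with I c (\<lambda>_. 1) x z" "\<alpha> \<in> {0..<1}"
  shows "\<alpha> \<le> z"
proof -
  obtain J where J: "J \<subseteq> I" "\<exists>\<beta> :: 'a \<Rightarrow> real. (\<forall>i\<in>J. \<beta> i \<in> {0..<1}) \<and>
      (\<forall>z p. coherent_with J c p x z \<and> (\<forall>i\<in>J. p i \<ge> \<beta> i) \<longrightarrow> z \<ge> \<alpha>)"
    using assms(1,3) unfolding p_entails_def by blast
  then obtain \<beta> :: "'a \<Rightarrow> real" where \<beta>: "\<forall>i\<in>J. \<beta> i \<in> {0..<1}"
      "\<And>z p. coherent_with J c p x z \<and> (\<forall>i\<in>J. p i \<ge> \<beta> i) \<Longrightarrow> z \<ge> \<alpha>" by blast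
  have "coherent_with J c (\<lambda>_. 1) x z" using coherent_with_subset[OF assms(2) J(1)] .
  then show ?thesis using \<beta>(1) by (intro \<beta>(2)) auto
qed

text \<open>By \<open>uncertainty_bound\<close> for the negated conclusion with price \<open>1 - z\<close>, the uncertainty \<open>1 - z\<close> of the
  conclusion is at most the sum of the uncertainties of the premises in \<open>S\<close>. Since \<open>S\<close> may
  be empty, while p-entailment asks for a nonempty set of premises, all of \<open>I\<close> is taken, with
  the allowed uncertainty \<open>1 - \<alpha>\<close> shared equally.\<close>

lemma not_tolerated_imp_p_entails:
  assumes fin: "finite I" "I \<noteq> {}" and I: "\<forall>i\<in>I. is_cond_event (c i)" and pc: "p_consistent I c"
    and x: "is_cond_event x" and S: "S \<subseteq> I"
    and nt: "\<not> tolerated (case_option (negated x) c) (insert None (Some ` S))"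
  shows "p_entails I c x"
  unfolding p_entails_def
proof (intro conjI exI[of _ I] allI impI)
  fix \<alpha> :: real assume \<alpha>: "\<alpha> \<in> {0..<1}"
  define e where "e = (1 - \<alpha>) / card I"
  have card: "real (card I) \<ge> 1" using fin by (simp add: Suc_le_eq card_gt_0_iff)
  have "e > 0" using \<alpha> card by (simp add: e_def)
  have "e \<le> 1 - \<alpha>" using \<alpha> card by (simp add: e_def divide_le_eq mult_left_le)
  then have e: "e \<le> 1" using \<alpha> by simp
  have "\<alpha> \<le> z" if coh: "coherent_with I c p x z" and p: "\<forall>i\<in>I. p i \<ge> 1 - e" for z p
  proof -
    have finS: "finite S" using S fin finite_subset by blast
    have "coherent (insert None (Some ` I)) (case_option (negated x) c) (case_option (1 - z) p)"
      using coherent_with_negated_imp[OF coh fin(1)] by (simp add: coherent_with_def)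
    then have "1 \<le> (\<Sum>j\<in>insert None (Some ` S). 1 - case_option (1 - z) p j)"
      by (rule uncertainty_bound[OF _ _ _ _ _ nt]) (use S finS I x in auto)
    also have "\<dots> = z + (\<Sum>i\<in>S. 1 - p i)"
      using finS by (subst sum.insert) (auto simp: sum.reindex)
    also have "(\<Sum>i\<in>S. 1 - p i) \<le> of_nat (card S) * e"
      using p S by (intro sum_bounded_above) fastforce
    also have "\<dots> \<le> card I * e"
      using card_mono[OF fin(1) S] \<open>e > 0\<close> by (intro mult_right_mono) auto
    also have "\<dots> = 1 - \<alpha>" using card by (simp add: e_def)
    finally show ?thesis by simp
  qed
  then show "\<exists>\<beta>. (\<forall>i\<in>I. \<beta> i \<in> {0..<1}) \<and>
      (\<forall>z p. coherent_with I c p x z \<and> (\<forall>i\<in>I. \<beta> i \<le> p i) \<longrightarrow> \<alpha> \<le> z)"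
    using e \<open>e > 0\<close> by (intro exI[of _ "\<lambda>_. 1 - e"]) auto
qed (use fin pc in auto)

lemma p_entails_iff_not_coherent_zero:
  assumes "finite I" "I \<noteq> {}" "\<forall>i\<in>I. is_cond_event (c i)" "p_consistent I c" "is_cond_event x"
  shows "p_entails I c x \<longleftrightarrow> \<not> coherent_with I c (\<lambda>_. 1) x 0"
proof
  assume "p_entails I c x"
  then show "\<not> coherent_with I c (\<lambda>_. 1) x 0"
    using p_entails_coherent_one[of I c x 0 "1/2"] by auto
next
  assume "\<not> coherent_with I c (\<lambda>_. 1) x 0"
  then obtain S where "S \<subseteq> I" "\<not> tolerated (case_option (negated x) c) (insert None (Some ` S))"
    using coherent_with_zero_iff[OF assms(1,3,4,5)] by blast
  then show "p_entails I c x" using not_tolerated_imp_p_entails[OF assms] by blast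
qed

text \<open>Suppose that \<open>S\<close> rejects the negation of \<open>x\<close> and \<open>T\<close> rejects \<open>x\<close>. A case that falsifies nothing in
  \<open>S \<union> T\<close> cannot meet \<open>hyp x\<close>, either part of which is excluded; outside \<open>hyp x\<close> it cannot make any
  hypothesis in \<open>S\<close> or in \<open>T\<close> true either. But by p-consistency \<open>S \<union> T\<close> is tolerated, or else it is
  empty and then \<open>hyp x\<close> itself would be impossible.\<close>

lemma tolerated_insert_negated:
  assumes "finite I" "\<forall>i\<in>I. is_cond_event (c i)" "p_consistent I c" "is_cond_event x"
    and S: "S \<subseteq> I" "\<not> tolerated (case_option (negated x) c) (insert None (Some ` S))"
    and T: "T \<subseteq> I"
  shows "tolerated (case_option x c) (insert None (Some ` T))"
proof (rule ccontr)
  assume nt: "\<not> ?thesis"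
  have no: "y = bot" if "y \<le> hyp x \<or> (\<exists>j\<in>S. y \<le> hyp (c j))" "inf y (hyp x) \<le> - event x"
    "\<forall>i\<in>S. inf y (hyp (c i)) \<le> event (c i)" for y
    using S(2) that unfolding tolerated_insert by auto
  have yes: "y = bot" if "y \<le> hyp x \<or> (\<exists>j\<in>T. y \<le> hyp (c j))" "inf y (hyp x) \<le> event x"
    "\<forall>i\<in>T. inf y (hyp (c i)) \<le> event (c i)" for y
    using nt that unfolding tolerated_insert by auto
  have sub: "inf (inf y a) (hyp (c i)) \<le> event (c i)"
    if "inf y (hyp (c i)) \<le> event (c i)" for y a i
    using that by (metis inf_commute inf_left_commute le_infI2)
  \<comment> \<open>The excluded middle for \<open>event x\<close>, inside \<open>hyp x\<close>.\<close>
  have meets_x: "inf y (hyp x) = bot"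
    if y: "\<forall>i\<in>S\<union>T. inf y (hyp (c i)) \<le> event (c i)" for y
  proof -
    have "inf y (inf (hyp x) (event x)) = bot"
      by (rule yes) (use y sub in \<open>auto intro: le_infI1 le_infI2\<close>)
    moreover have "inf y (inf (hyp x) (- event x)) = bot"
      by (rule no) (use y sub in \<open>auto intro: le_infI1 le_infI2\<close>)
    ultimately show ?thesis
      by (metis inf_assoc inf_shunt le_compl_le_imp_bot double_compl)
  qed
  show False
  proof (cases "S \<union> T = {}")
    case True
    then show False using meets_x[of top] assms(4) by (auto simp: is_cond_event_def)
  next
    case False
    then have "tolerated c (S \<union> T)"
      using p_consistent_iff[OF assms(1,2), THEN iffD1, OF assms(3)] S(1) T False by (metis Un_least)
    then obtain y j where y: "y \<noteq> bot" "j \<in> S \<union> T" "y \<le> hyp (c j)"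
      "\<forall>i\<in>S\<union>T. inf y (hyp (c i)) \<le> event (c i)"
      unfolding tolerated_def by blast
    then show False using meets_x[OF y(4)] yes[of y] no[of y] by auto
  qed
qed

lemma p_entails_iff_coherent_only_one:
  assumes "finite I" "I \<noteq> {}" "\<forall>i\<in>I. is_cond_event (c i)" "p_consistent I c" "is_cond_event x"
  shows "p_entails I c x \<longleftrightarrow> (\<forall>z. coherent_with I c (\<lambda>_. 1) x z \<longleftrightarrow> z = 1)"
proof (rule iffI[OF allI])
  assume "\<forall>z. coherent_with I c (\<lambda>_. 1) x z \<longleftrightarrow> z = 1"
  then show "p_entails I c x" using p_entails_iff_not_coherent_zero[OF assms] by force
next
  fix z assume ent: "p_entails I c x"
  show "coherent_with I c (\<lambda>_. 1) x z \<longleftrightarrow> z = 1"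
  proof
    assume coh: "coherent_with I c (\<lambda>_. 1) x z"
    have "1 \<le> z"
    proof (rule dense_le)
      fix \<alpha> :: real assume "\<alpha> < 1"
      (* p-entailment only speaks of thresholds in [0,1), hence the maximum with 0 *)
      show "\<alpha> \<le> z"
        using p_entails_coherent_one[OF ent coh, of "max 0 \<alpha>"] \<open>\<alpha> < 1\<close> by auto
    qed
    then show "z = 1" using coherent_with_le_1[OF coh] assms by simp
  next
    assume "z = 1"
    obtain S where "S \<subseteq> I" "\<not> tolerated (case_option (negated x) c) (insert None (Some ` S))"
      using ent p_entails_iff_not_coherent_zero[OF assms] coherent_with_zero_iff[OF assms(1,3,4,5)] by blast
    then show "coherent_with I c (\<lambda>_. 1) x z"
      unfolding \<open>z = 1\<close> coherent_with_one_iff[OF assms(1,3,4,5)]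
      using tolerated_insert_negated[OF assms(1,3,4,5)] by blast
  qed
qed

section \<open>Quasi conjunction\<close>

lemma le_event_quasi_conj_iff:
  assumes "finite S" "S \<noteq> {}"
  shows "y \<le> event (quasi_conj c S) \<longleftrightarrow> (\<forall>i\<in>S. inf y (hyp (c i)) \<le> event (c i))"
proof -
  have "y \<le> sup (inf e h) (- h) \<longleftrightarrow> inf y h \<le> e" for e h :: 'b
  proof -
    have "sup (inf e h) (- h) = sup (- h) e"
      by (simp add: sup_inf_distrib1 sup_commute[of _ "- h"])
    then show ?thesis by (metis double_compl shunt2 diff_eq shunt1)
  qed
  then show ?thesis
    unfolding quasi_conj_def using assms by (simp add: Inf_fin.bounded_iff)
qed

text \<open>Write \<open>A|K\<close> for the quasi conjunction, so that \<open>y \<le> A\<close> means that \<open>y\<close> falsifies no member of \<open>S\<close>. A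
  tolerating case for \<open>S\<close> and the negation of \<open>E|H\<close> is a nonzero \<open>y \<le> A\<close> below \<open>K\<close> or \<open>H\<close> with
  \<open>y \<sqinter> H \<le> E\<^sup>c\<close>. One below \<open>K\<close> refutes \<open>AK \<subseteq> EH\<close>, one below \<open>H\<close> refutes \<open>E\<^sup>cH \<subseteq> A\<^sup>cK\<close>, and
  conversely; here \<open>A\<^sup>c \<subseteq> K\<close>, because falsifying a member makes its hypothesis true.\<close>

lemma gn_implies_quasi_conj_iff:
  fixes c :: "'i \<Rightarrow> 'a::boolean_algebra cond_event"
  assumes "finite S" "S \<noteq> {}"
  shows "gn_implies (quasi_conj c S) x \<longleftrightarrow>
    \<not> tolerated (case_option (negated x) c) (insert None (Some ` S))"
proof -
  define A where "A = event (quasi_conj c S)"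
  define K where "K = disj_hyps c S"
  have hypq: "hyp (quasi_conj c S) = K" by (simp add: quasi_conj_def K_def)
  have A: "y \<le> A \<longleftrightarrow> (\<forall>i\<in>S. inf y (hyp (c i)) \<le> event (c i))" for y
    unfolding A_def using le_event_quasi_conj_iff[OF assms] .
  have hypK: "hyp (c i) \<le> K" if "i \<in> S" for i
    unfolding K_def using hyp_le_disj_hyps assms(1) that .
  let ?E = "event x" and ?H = "hyp x"
  have tol: "tolerated (case_option (negated x) c) (insert None (Some ` S)) \<longleftrightarrow>
     (\<exists>y. y \<noteq> bot \<and> (y \<le> ?H \<or> (\<exists>j\<in>S. y \<le> hyp (c j))) \<and> inf y ?H \<le> - ?E \<and> y \<le> A)"
    unfolding tolerated_insert A by simp
  show ?thesis
  proof
    assume gn: "gn_implies (quasi_conj c S) x"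
    then have 1: "inf A K \<le> inf ?E ?H" and 2: "inf (- ?E) ?H \<le> inf (- A) K"
      by (simp_all add: gn_implies_def hypq A_def)
    have "y = bot" if y: "y \<le> ?H \<or> (\<exists>j\<in>S. y \<le> hyp (c j))" "inf y ?H \<le> - ?E" "y \<le> A" for y
      using y(1)
    proof
      assume "y \<le> ?H"
      then have "y \<le> - A" using y(2) 2 by (metis inf.absorb1 inf.bounded_iff order_trans)
      then show ?thesis using y(3) le_compl_le_imp_bot by blast
    next
      assume "\<exists>j\<in>S. y \<le> hyp (c j)"
      then have "y \<le> inf ?E ?H" using y(3) hypK 1 by (meson inf_greatest order_trans)
      then show ?thesis using y(2) le_compl_le_imp_bot by (metis inf.absorb1 inf.bounded_iff)
    qed
    then show "\<not> tolerated (case_option (negated x) c) (insert None (Some ` S))"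
      unfolding tol by blast
  next
    assume "\<not> tolerated (case_option (negated x) c) (insert None (Some ` S))"
    then have no: "y = bot"
      if "y \<le> ?H \<or> (\<exists>j\<in>S. y \<le> hyp (c j))" "inf y ?H \<le> - ?E" "y \<le> A" for y
      unfolding tol using that by blast
    have "hyp (c j) \<le> - inf A (- inf ?E ?H)" if "j \<in> S" for j
    proof -
      have "inf (inf A (- inf ?E ?H)) (hyp (c j)) = bot"
      proof (rule no)
        have "inf (- inf ?E ?H) ?H \<le> - ?E"
          by (simp add: inf_sup_distrib2)
        then show "inf (inf (inf A (- inf ?E ?H)) (hyp (c j))) ?H \<le> - ?E"
          by (meson inf_le1 inf_le2 inf_mono le_infI1 order_refl order_trans)
      next
        have "inf (inf A (- inf ?E ?H)) (hyp (c j)) \<le> hyp (c j)" by (rule inf_le2)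
        then show "inf (inf A (- inf ?E ?H)) (hyp (c j)) \<le> ?H \<or>
            (\<exists>k\<in>S. inf (inf A (- inf ?E ?H)) (hyp (c j)) \<le> hyp (c k))"
          using that by blast
      qed (simp add: le_infI1)
      then show ?thesis by (metis inf_commute inf_shunt)
    qed
    then have "K \<le> - inf A (- inf ?E ?H)"
      unfolding K_def using assms by (simp add: disj_hyps_le_iff)
    then have 1: "inf A K \<le> inf ?E ?H"
      by (metis inf_shunt inf_commute inf_left_commute double_compl)
    have "inf (inf (- ?E) ?H) A = bot"
      by (rule no) (auto intro: le_infI1)
    then have "inf (- ?E) ?H \<le> - A" by (metis inf_shunt)
    moreover have "- A \<le> K"
    proof -
      have "inf (- K) (hyp (c i)) = bot" if "i \<in> S" for i
        using hypK[OF that] by (metis inf_shunt compl_le_compl_iff inf_commute double_compl)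
      then have "- K \<le> A" unfolding A by simp
      then show ?thesis by (metis compl_le_swap2)
    qed
    ultimately have "inf (- ?E) ?H \<le> inf (- A) K" by (meson inf_greatest order_trans)
    with 1 show "gn_implies (quasi_conj c S) x" by (simp add: gn_implies_def hypq A_def)
  qed
qed

lemma tolerated_empty_insert_negated_iff:
  "tolerated (case_option (negated x) c) (insert None (Some ` {})) \<longleftrightarrow> \<not> hyp x \<le> event x"
proof -
  have "hyp x \<le> event x \<longleftrightarrow> inf (hyp x) (- event x) = bot" by (metis inf_shunt double_compl)
  moreover have "y = bot" if "y \<le> hyp x" "inf y (hyp x) \<le> - event x" "hyp x \<le> event x" for y
    using that le_compl_le_imp_bot by (metis inf.absorb1 order_trans)
  ultimately show ?thesis
    unfolding tolerated_insert
    by (auto intro!: exI[of _ "inf (hyp x) (- event x)"] intro: le_infI1)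
qed

lemma p_entails_iff_gn_implies:
  assumes "finite I" "I \<noteq> {}" "\<forall>i\<in>I. is_cond_event (c i)" "p_consistent I c" "is_cond_event x"
  shows "p_entails I c x \<longleftrightarrow>
    (\<exists>S. S \<subseteq> I \<and> S \<noteq> {} \<and> gn_implies (quasi_conj c S) x) \<or> hyp x \<le> event x"
proof -
  have "p_entails I c x \<longleftrightarrow>
    (\<exists>S\<subseteq>I. \<not> tolerated (case_option (negated x) c) (insert None (Some ` S)))"
    using p_entails_iff_not_coherent_zero[OF assms] coherent_with_zero_iff[OF assms(1,3,4,5)] by blast
  also have "\<dots> \<longleftrightarrow> (\<exists>S. S \<subseteq> I \<and> S \<noteq> {} \<and> gn_implies (quasi_conj c S) x) \<or> hyp x \<le> event x"
    using gn_implies_quasi_conj_iff finite_subset[OF _ assms(1)]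
      tolerated_empty_insert_negated_iff[of x c]
    by (metis empty_subsetI)
  finally show ?thesis .
qed

lemma tolerated_quasi_conj:
  assumes "finite S" "S \<noteq> {}" "tolerated c S"
  shows "tolerated (\<lambda>_. quasi_conj c S) {()}"
proof -
  obtain y j where y: "y \<noteq> bot" "j \<in> S" "y \<le> hyp (c j)"
    "\<forall>i\<in>S. inf y (hyp (c i)) \<le> event (c i)"
    using assms(3) unfolding tolerated_def by blast
  have "y \<le> event (quasi_conj c S)" using le_event_quasi_conj_iff[OF assms(1,2)] y(4) by blast
  moreover have "y \<le> hyp (quasi_conj c S)"
    using y(2,3) hyp_le_disj_hyps[OF assms(1) y(2), of c] by (simp add: quasi_conj_def)
  ultimately show ?thesis
    unfolding tolerated_def using y(1) by (auto intro: le_infI1)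
qed

text \<open>The quasi conjunction of one conditional event is that conditional event.\<close>

lemma p_entails_single_iff:
  assumes "is_cond_event y" "p_consistent {()} (\<lambda>_. y)" "is_cond_event x"
  shows "p_entails_single y x \<longleftrightarrow> gn_implies y x \<or> hyp x \<le> event x"
proof -
  have "gn_implies (quasi_conj (\<lambda>_. y) {()}) x \<longleftrightarrow> gn_implies y x"
    by (simp add: quasi_conj_def disj_hyps_def gn_implies_def inf_sup_distrib1 inf_sup_distrib2)
  moreover have "S \<subseteq> {()} \<and> S \<noteq> {} \<longleftrightarrow> S = {()}" for S by auto
  ultimately show ?thesis
    unfolding p_entails_single_def using p_entails_iff_gn_implies[of "{()}" "\<lambda>_. y" x] assms
    by (metis finite.emptyI finite.insertI insert_not_empty)
qed

text \<open>Since \<open>S\<close> is tolerated, its quasi conjunction can be true and hence is p-consistent by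
  itself. If \<open>hyp x \<le> event x\<close>, any nonempty \<open>S\<close> will do.\<close>

lemma p_entails_iff_quasi_conj_p_entails:
  assumes "finite I" "I \<noteq> {}" "\<forall>i\<in>I. is_cond_event (c i)" "p_consistent I c" "is_cond_event x"
  shows "p_entails I c x \<longleftrightarrow>
    (\<exists>S. S \<subseteq> I \<and> S \<noteq> {} \<and> p_entails_single (quasi_conj c S) x)"
proof -
  have "p_entails_single (quasi_conj c S) x \<longleftrightarrow>
      gn_implies (quasi_conj c S) x \<or> hyp x \<le> event x" if S: "S \<subseteq> I" "S \<noteq> {}" for S
  proof -
    have fin: "finite S" using S(1) assms(1) finite_subset by blast
    have "tolerated c S" using p_consistent_iff[OF assms(1,3), THEN iffD1, OF assms(4)] S by blast
    then have tol: "tolerated (\<lambda>_. quasi_conj c S) {()}" using tolerated_quasi_conj fin S(2) by blast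
    then have ce: "is_cond_event (quasi_conj c S)"
      unfolding tolerated_def is_cond_event_def by (auto simp: bot_unique)
    have "J \<subseteq> {()} \<and> J \<noteq> {} \<longleftrightarrow> J = {()}" for J by auto
    then have "p_consistent {()} (\<lambda>_. quasi_conj c S)"
      using p_consistent_iff[of "{()}" "\<lambda>_. quasi_conj c S"] ce tol by auto
    then show ?thesis using p_entails_single_iff ce assms(5) by blast
  qed
  then show ?thesis
    using p_entails_iff_gn_implies[OF assms] assms(2) by blast
qed

theorem theorem6:
  fixes F :: "nat \<Rightarrow> 'a::boolean_algebra cond_event" and n :: nat and E H :: 'a
  assumes "n \<ge> 1"
    and "\<forall>i\<in>{1..n}. is_cond_event (F i)"
    and "p_consistent {1..n} F"
    and "is_cond_event (Cond E H)"
  shows "(p_entails {1..n} F (Cond E H) \<longleftrightarrow>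
            (\<forall>z. coherent_with {1..n} F (\<lambda>_. 1) (Cond E H) z \<longleftrightarrow> z = 1)) \<and>
         (p_entails {1..n} F (Cond E H) \<longleftrightarrow>
            \<not> coherent_with {1..n} F (\<lambda>_. 1) (Cond E H) 0) \<and>
         (p_entails {1..n} F (Cond E H) \<longleftrightarrow>
            (\<exists>S. S \<subseteq> {1..n} \<and> S \<noteq> {} \<and> gn_implies (quasi_conj F S) (Cond E H)) \<or> H \<le> E) \<and>
         (p_entails {1..n} F (Cond E H) \<longleftrightarrow>
            (\<exists>S. S \<subseteq> {1..n} \<and> S \<noteq> {} \<and> p_entails_single (quasi_conj F S) (Cond E H)))"
proof -
  have I: "finite {1..n}" "{1..n} \<noteq> {}" using assms(1) by auto
  note A = I assms(2-4)
  show ?thesis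
    using p_entails_iff_coherent_only_one[OF A] p_entails_iff_not_coherent_zero[OF A]
      p_entails_iff_gn_implies[OF A] p_entails_iff_quasi_conj_p_entails[OF A]
    unfolding cond_event.sel by blast
qed

end
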